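(* (Duality involution.) Let $\omega:\mathbb{A}\to\mathbb{A}$ be the ring homomorphism determined by $\omega(u_r)=v_r$ for every integer $r$, where $v_r=U_{(1^r)}$ for $r\ge 1$, $v_0=1$, and $v_r=0$ for $r<0$. Then $\omega(U_\lambda)=U_{\lambda'}$ for every partition $\lambda$, where $\lambda'$ is the conjugate partition of $\lambda$. In particular, $\omega$ is an involution of $\mathbb{A}$.
   Context: An integer sequence (integer vector) is a sequence $\alpha=(\alpha_1,\alpha_2,\ldots)$ of integers with only finitely many nonzero terms; it is a partition if $\alpha_i\ge\alpha_{i+1}\ge 0$ for all $i$. $(1^r)$ denotes the partition with $r$ parts equal to $1$. Let $\mathbb{A}=\mathbb{Z}[u_1,u_2,\ldots]$ be the polynomial ring in countably many independent variables, with $u_0=1$ and $u_r=0$ for $r<0$. For an integer vector $\alpha$ put $u_\alpha=\prod_i u_{\alpha_i}$. For $i<j$ let $R_{ij}(\alpha)=(\alpha_1,\ldots,\alpha_i+1,\ldots,\alpha_j-1,\ldots)$; a raising operator $R$ is a monomial in the $R_{ij}$, and $R\,u_\alpha:=u_{R\alpha}$ (the operator acts on the index $\alpha$). The Schur polynomial of an integer vector $\alpha$ is $$U_\alpha:=\prod_{i<j}(1-R_{ij})\,u_\alpha\in\mathbb{A};$$ after formal expansion only finitely many summands are nonzero. The conjugate partition $\lambda'$ is given by $\lambda'_i=\#\{j\mid\lambda_j\ge i\}$ for all $i$. *)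

theory Defs
  imports "HOL-Library.Poly_Mapping"
begin

text \<open>
  Integer sequences \<open>(\<alpha>\<^sub>1, \<alpha>\<^sub>2, \<dots>)\<close> with finitely many nonzero terms. Positions are counted
  from \<open>0\<close>: the entry \<open>\<alpha>\<^sub>i\<close> with \<open>i \<ge> 1\<close> is \<open>lookup \<alpha> (i - 1)\<close>.
\<close>
type_synonym intseq = "nat \<Rightarrow>\<^sub>0 int"

abbreviation entry :: "intseq \<Rightarrow> nat \<Rightarrow> int"
  where "entry \<equiv> Poly_Mapping.lookup"

definition is_partition :: "intseq \<Rightarrow> bool"
  where "is_partition \<alpha> \<longleftrightarrow> (\<forall>i. entry \<alpha> i \<ge> entry \<alpha> (Suc i) \<and> entry \<alpha> (Suc i) \<ge> 0)"

text \<open>The partition \<open>(1\<^sup>r)\<close>.\<close>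
lift_definition ones :: "nat \<Rightarrow> intseq"
  is "\<lambda>r i. if i < r then 1 else 0"
  by simp

text \<open>
  \<open>\<lambda>'\<^sub>i = #{j | \<lambda>\<^sub>j \<ge> i}\<close> for \<open>i \<ge> 1\<close>; in the 0-based numbering the value \<open>i\<close> becomes \<open>i + 1\<close>.
\<close>
lift_definition conjugate :: "intseq \<Rightarrow> intseq"
  is "\<lambda>l i. int (card {j. l j \<ge> int (i + 1)})"
proof -
  fix l :: "nat \<Rightarrow> int"
  assume fin: "finite {k. l k \<noteq> 0}"
  define M where "M = Max (insert 0 (l ` {k. l k \<noteq> 0}))"
  have M: "l k \<le> M" for k
  proof (cases "l k = 0")
    case True
    then show ?thesis unfolding M_def using fin by simp
  next
    case False
    then show ?thesis unfolding M_def using fin by (intro Max_ge) auto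
  qed
  have "{i. int (card {j. l j \<ge> int (i + 1)}) \<noteq> 0} \<subseteq> {..nat M}"
  proof
    fix i assume "i \<in> {i. int (card {j. l j \<ge> int (i + 1)}) \<noteq> 0}"
    then have "{j. l j \<ge> int (i + 1)} \<noteq> {}" by force
    then obtain j where "l j \<ge> int (i + 1)" by blast
    with M[of j] show "i \<in> {..nat M}" by simp
  qed
  then show "finite {i. int (card {j. l j \<ge> int (i + 1)}) \<noteq> 0}"
    using finite_subset by blast
qed

text \<open>
  The polynomial ring \<open>\<int>[u\<^sub>1, u\<^sub>2, \<dots>]\<close>: finitely supported maps from monomials (exponent
  functions) to integer coefficients. The variable \<open>u\<^sub>r\<close>, \<open>r \<ge> 1\<close>, has index \<open>r - 1\<close>.
\<close>
type_synonym upoly = "(nat \<Rightarrow>\<^sub>0 nat) \<Rightarrow>\<^sub>0 int"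

definition u :: "int \<Rightarrow> upoly"
  where "u r = (if r < 0 then 0 else if r = 0 then 1
                else Poly_Mapping.single (Poly_Mapping.single (nat r - 1) 1) 1)"

text \<open>A product with finitely many factors different from \<open>1\<close>, since \<open>u\<^sub>0 = 1\<close>.\<close>
definition u_seq :: "intseq \<Rightarrow> upoly"
  where "u_seq \<alpha> = (\<Prod>i. u (entry \<alpha> i))"

definition R :: "nat \<Rightarrow> nat \<Rightarrow> intseq \<Rightarrow> intseq"
  where "R i j \<alpha> = \<alpha> + Poly_Mapping.single i 1 - Poly_Mapping.single j 1"

text \<open>
  The squarefree raising operator \<open>\<Prod>\<^bsub>(i,j) \<in> S\<^esub> R\<^sub>i\<^sub>j\<close> for a finite set \<open>S\<close> of index pairs;
  the \<open>R\<^sub>i\<^sub>j\<close> commute, so the order of application is irrelevant.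
\<close>
definition raising :: "(nat \<times> nat) set \<Rightarrow> intseq \<Rightarrow> intseq"
  where "raising S \<alpha> = Finite_Set.fold (\<lambda>(i, j). R i j) \<alpha> S"

definition index_pairs :: "(nat \<times> nat) set"
  where "index_pairs = {(i, j). i < j}"

text \<open>
  Formal expansion of \<open>\<Prod>\<^bsub>i<j\<^esub> (1 - R\<^sub>i\<^sub>j)\<close>: choosing the summand \<open>- R\<^sub>i\<^sub>j\<close> in the factors
  indexed by a finite set \<open>S\<close> and \<open>1\<close> in all others yields \<open>(-1)\<^bsup>|S|\<^esup> \<Prod>\<^bsub>(i,j) \<in> S\<^esub> R\<^sub>i\<^sub>j\<close>.
\<close>
definition U_summand :: "intseq \<Rightarrow> (nat \<times> nat) set \<Rightarrow> upoly"
  where "U_summand \<alpha> S =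
    (if finite S \<and> S \<subseteq> index_pairs then (- 1) ^ card S * u_seq (raising S \<alpha>) else 0)"

text \<open>The sum has finite support by lemma \<open>finite_U_summand\<close> below.\<close>
definition U :: "intseq \<Rightarrow> upoly"
  where "U \<alpha> = (\<Sum>S. U_summand \<alpha> S)"

definition v :: "int \<Rightarrow> upoly"
  where "v r = (if r < 0 then 0 else if r = 0 then 1 else U (ones (nat r)))"


lemma finite_u_neq_1: "finite {i. u (entry \<alpha> i) \<noteq> 1}"
proof (rule finite_subset)
  show "{i. u (entry \<alpha> i) \<noteq> 1} \<subseteq> Poly_Mapping.keys \<alpha>"
    by (auto simp: u_def in_keys_iff)
qed simp

interpretation R_commute: comp_fun_commute "\<lambda>(i, j). R i j"
  by standard (auto simp: R_def fun_eq_iff algebra_simps)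

lemma raising_empty: "raising {} \<alpha> = \<alpha>"
  by (simp add: raising_def)

lemma raising_insert:
  "finite S \<Longrightarrow> (i, j) \<notin> S \<Longrightarrow> raising (insert (i, j) S) \<alpha> = R i j (raising S \<alpha>)"
  by (simp add: raising_def)

lemma entry_raising:
  "finite S \<Longrightarrow>
    entry (raising S \<alpha>) k = entry \<alpha> k + (\<Sum>(i, j)\<in>S. (1 when i = k) - (1 when j = k))"
proof (induction S rule: finite_induct)
  case empty
  then show ?case by (simp add: raising_empty)
next
  case (insert p S)
  then show ?case
    by (cases p) (simp add: raising_insert R_def lookup_add lookup_minus lookup_single)
qed

lemma finite_U_summand: "finite {S. U_summand \<alpha> S \<noteq> 0}"
proof -
  obtain n where n: "\<And>k. k \<ge> n \<Longrightarrow> entry \<alpha> k = 0"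
  proof -
    obtain n where "\<forall>k\<in>Poly_Mapping.keys \<alpha>. k < n"
      using finite_nat_set_iff_bounded[of "Poly_Mapping.keys \<alpha>"] by auto
    then have "entry \<alpha> k = 0" if "k \<ge> n" for k
      using that by (meson in_keys_iff not_le)
    then show ?thesis by (rule that)
  qed
  have "S \<subseteq> {..<n} \<times> {..<n}" if nz: "U_summand \<alpha> S \<noteq> 0" for S
  proof (rule ccontr)
    assume not: "\<not> S \<subseteq> {..<n} \<times> {..<n}"
    from nz have fin: "finite S" and sub: "S \<subseteq> index_pairs" and u: "u_seq (raising S \<alpha>) \<noteq> 0"
      by (auto simp: U_summand_def split: if_splits)
    define J where "J = Max (snd ` S)"
    from not sub obtain i j where ij: "(i, j) \<in> S" "j \<ge> n"
      by (fastforce simp: index_pairs_def)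
    then have ne: "snd ` S \<noteq> {}" by auto
    have le: "b \<le> J" if "(a, b) \<in> S" for a b
      unfolding J_def using fin that by (intro Max_ge) force+
    have "J \<in> snd ` S"
      unfolding J_def using fin ne by (intro Max_in) auto
    then obtain i' where i': "(i', J) \<in> S" by auto
    have "J \<ge> n" using le[OF ij(1)] ij(2) by simp
    then have zero: "entry \<alpha> J = 0" by (rule n)
    have noleft: "a \<noteq> J" if "(a, b) \<in> S" for a b
      using le[OF that] sub that by (auto simp: index_pairs_def)
    have "(\<Sum>(a, b)\<in>S. ((1::int) when a = J) - (1 when b = J)) = (\<Sum>(a, b)\<in>S. - (1 when b = J))"
      by (rule sum.cong) (auto dest: noleft)
    also have "\<dots> < (\<Sum>(a, b)\<in>S. 0)"
      by (rule sum_strict_mono_ex1[OF fin]) (auto simp: when_def intro!: bexI[OF _ i'])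
    finally have "entry (raising S \<alpha>) J < 0"
      using entry_raising[OF fin, of \<alpha> J] zero by simp
    then have "u (entry (raising S \<alpha>) J) = 0" by (simp add: u_def)
    then have "u_seq (raising S \<alpha>) = 0"
      unfolding u_seq_def by (rule Prod_any_zero[OF finite_u_neq_1])
    with u show False by simp
  qed
  then have "{S. U_summand \<alpha> S \<noteq> 0} \<subseteq> Pow ({..<n} \<times> {..<n})" by blast
  then show ?thesis by (rule finite_subset) simp
qed

definition u_hom :: "(upoly \<Rightarrow> upoly) \<Rightarrow> bool"
  where "u_hom h \<longleftrightarrow> h 1 = 1 \<and> (\<forall>p q. h (p + q) = h p + h q) \<and> (\<forall>p q. h (p * q) = h p * h q)"

lemma u_hom_diff: "u_hom h \<Longrightarrow> h (p - q) = h p - h q"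
  unfolding u_hom_def by (metis add_diff_cancel_right' diff_add_cancel)

lemma ex1_duality_hom: "\<exists>!\<omega>. u_hom \<omega> \<and> (\<forall>r. \<omega> (u r) = v r)"
proof
  define mon :: "(nat \<Rightarrow>\<^sub>0 nat) \<Rightarrow> upoly"
    where "mon m = (\<Prod>i. v (int i + 1) ^ Poly_Mapping.lookup m i)" for m
  have fin: "finite {i. v (int i + 1) ^ Poly_Mapping.lookup m i \<noteq> 1}" for m
  proof (rule finite_subset)
    show "{i. v (int i + 1) ^ Poly_Mapping.lookup m i \<noteq> 1} \<subseteq> Poly_Mapping.keys m"
      by (metis (mono_tags, lifting) in_keys_iff mem_Collect_eq power_0 subsetI)
  qed simp
  have mon_0: "mon 0 = 1" by (simp add: mon_def)
  have mon_add: "mon (m + m') = mon m * mon m'" for m m'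
    by (simp add: mon_def lookup_add power_add Prod_any.distrib[OF fin fin])
  have mon_single: "mon (Poly_Mapping.single k 1) = v (int k + 1)" for k
  proof -
    have eq: "(\<lambda>i. v (int i + 1) ^ Poly_Mapping.lookup (Poly_Mapping.single k 1) i)
        = (\<lambda>i. if i = k then v (int i + 1) else 1)"
      by (auto simp: lookup_single when_def)
    show ?thesis unfolding mon_def eq by simp
  qed
  define w :: "upoly \<Rightarrow> upoly" where "w = frag_extend mon"
  have w_diff: "w (p - q) = w p - w q" for p q
    by (simp add: w_def frag_extend_diff)
  have w_single: "w (frag_of m) = mon m" for m
    by (simp add: w_def)
  have w_0: "w 0 = 0" by (simp add: w_def)
  have w_1: "w 1 = 1" using w_single[of 0] by (simp add: mon_0)
  have w_mult1: "w (frag_of m * q) = mon m * w q" for m q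
    using subset_UNIV[of "Poly_Mapping.keys q"]
    by (induction q rule: frag_induction)
      (simp_all add: w_0 w_single mult_single mon_add w_diff algebra_simps)
  have w_mult: "w (p * q) = w p * w q" for p q
    using subset_UNIV[of "Poly_Mapping.keys p"]
    by (induction p rule: frag_induction)
      (simp_all add: w_0 w_single w_mult1 w_diff left_diff_distrib)
  have "w (u r) = v r" for r
    using w_single[of "Poly_Mapping.single (nat r - 1) 1"] mon_single[of "nat r - 1"]
    by (cases "r > 0") (auto simp: u_def w_0 w_1 v_def of_nat_diff)
  then show "u_hom w \<and> (\<forall>r. w (u r) = v r)"
    by (simp add: u_hom_def w_1 w_mult) (simp add: w_def frag_extend_add)
  fix h assume h: "u_hom h \<and> (\<forall>r. h (u r) = v r)"
  have h_0: "h 0 = 0" using h u_hom_diff[of h 0 0] by simp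
  have h_var: "h (frag_of (Poly_Mapping.single k n)) = w (frag_of (Poly_Mapping.single k n))" for k n
  proof (induction n)
    case 0
    then show ?case using h w_1 by (simp add: u_hom_def)
  next
    case (Suc n)
    have split: "frag_of (Poly_Mapping.single k (Suc n))
        = u (int k + 1) * frag_of (Poly_Mapping.single k n)"
      by (simp add: u_def mult_single single_add[symmetric] nat_add_distrib)
    show ?case
      unfolding split using h Suc \<open>\<And>r. w (u r) = v r\<close> by (simp add: u_hom_def w_mult)
  qed
  have h_mon: "h (frag_of m) = w (frag_of m)" for m
  proof (induction m rule: update_induct)
    case const
    then show ?case using h w_1 by (simp add: u_hom_def)
  next
    case (update m k n)
    have "Poly_Mapping.update k n m = Poly_Mapping.single k n + m"
      using update(1)
      by (intro poly_mapping_eqI) (auto simp: lookup_update lookup_add lookup_single in_keys_iff)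
    then have split: "frag_of (Poly_Mapping.update k n m)
        = frag_of (Poly_Mapping.single k n) * frag_of m"
      by (simp add: mult_single)
    show ?case unfolding split using h h_var update(3) by (simp add: u_hom_def w_mult)
  qed
  have "h p = w p" for p
    using subset_UNIV[of "Poly_Mapping.keys p"]
    by (induction p rule: frag_induction)
      (simp_all add: h_0 w_0 h_mon w_diff u_hom_diff[OF conjunct1[OF h]])
  then show "h = w" by blast
qed

end

theory Submission
  imports "Jordan_Normal_Form.Determinant" Defs
begin

text \<open>
  The proof goes through determinants. For large \<open>n\<close> the raising operator formula is the Jacobi-Trudi
  determinant \<open>U\<^sub>\<alpha> = det (u\<^bsub>\<alpha>\<^sub>i + j - i\<^esub>)\<close> of size \<open>n\<close>: in the group algebra of the integer vectors, with
  basis elements \<open>x\<^sup>\<alpha>\<close>, the operator \<open>R\<^sub>i\<^sub>j\<close> is multiplication by \<open>x\<^sub>i / x\<^sub>j\<close>, the product of all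
  \<open>1 - x\<^sub>i / x\<^sub>j\<close> with \<open>i < j < n\<close> is a rescaled Vandermonde determinant \<open>det (x\<^sub>i\<^bsup>j - i\<^esup>)\<close>, and the additive map
  \<open>x\<^sup>\<alpha> \<mapsto> u\<^sub>\<alpha>\<close> sends \<open>x\<^sup>\<alpha>\<close> times this determinant to the Jacobi-Trudi determinant
  (\<open>U_eq_jacobi_trudi\<close>).
  
  Call sequences \<open>h\<close> and \<open>e\<close> dual if \<open>\<Sum>\<^sub>i (-1)\<^sup>i e\<^sub>i h\<^bsub>r - i\<^esub> = 0\<close> for all \<open>r > 0\<close>, as the complete and elementary
  symmetric functions are. Equivalently, the Toeplitz matrices of \<open>h\<^sub>i\<close> and \<open>(-1)\<^sup>i e\<^sub>i\<close> are inverse to each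
  other, so a minor of one is up to sign the complementary minor of the other. Applied to the rows
  \<open>m + i - \<lambda>\<^sub>i\<close>, whose complement consists of the numbers \<open>m - 1 - k + \<lambda>'\<^sub>k\<close>, this gives
  \<open>det (h\<^bsub>\<lambda>\<^sub>i + j - i\<^esub>) = det (e\<^bsub>\<lambda>'\<^sub>i + j - i\<^esub>)\<close> (\<open>dual_jacobi_trudi\<close>); the two signs involved cancel
  (\<open>sign_two_runs\<close>).
  
  The case \<open>\<lambda> = (1\<^sup>r)\<close> identifies the sequence dual to \<open>u\<close> as \<open>v\<close>. Duality is symmetric, so
  \<open>\<omega> U\<^sub>\<lambda> = det (v\<^bsub>\<lambda>\<^sub>i + j - i\<^esub>) = det (u\<^bsub>\<lambda>'\<^sub>i + j - i\<^esub>)\<close>, which is the Schur polynomial of \<open>\<lambda>'\<close>. Finally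
  \<open>\<omega>\<close> maps the dual pair \<open>(u, v)\<close> to a dual pair \<open>(v, \<omega> v)\<close>; a sequence has only one dual, so
  \<open>\<omega> v = u\<close>, and \<open>\<omega> \<circ> \<omega>\<close> fixes the variables.
\<close>

section \<open>Dual pairs of sequences\<close>

definition dual_pair :: "(int \<Rightarrow> 'a::comm_ring_1) \<Rightarrow> (int \<Rightarrow> 'a) \<Rightarrow> bool" where
  "dual_pair h e \<longleftrightarrow> h 0 = 1 \<and> e 0 = 1 \<and> (\<forall>r<0. h r = 0 \<and> e r = 0) \<and>
    (\<forall>r>0. (\<Sum>i\<le>r. (-1) ^ i * e (int i) * h (int (r - i))) = 0)"

lemma dual_pair_recurrence:
  "dual_pair h e \<Longrightarrow> r > 0 \<Longrightarrow> (\<Sum>i\<le>r. (-1) ^ i * e (int i) * h (int (r - i))) = 0"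
  unfolding dual_pair_def by blast

text \<open>
  The substitution \<open>i \<mapsto> r - i\<close> changes the alternating sum only by the factor \<open>(-1)\<^sup>r\<close>.
\<close>
lemma dual_pair_sym:
  assumes "dual_pair h e" shows "dual_pair e h"
proof -
  have "(\<Sum>i\<le>r. (-1) ^ i * h (int i) * e (int (r - i))) = 0" if "r > 0" for r
  proof -
    have "(\<Sum>i\<le>r. (-1) ^ i * h (int i) * e (int (r - i)))
        = (\<Sum>i\<le>r. (-1) ^ (r - i) * h (int (r - i)) * e (int i))"
      by (rule sum.reindex_bij_witness[of _ "\<lambda>i. r - i" "\<lambda>i. r - i"]) auto
    also have "\<dots> = (-1) ^ r * (\<Sum>i\<le>r. (-1) ^ i * e (int i) * h (int (r - i)))"
      unfolding sum_distrib_left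
    proof (rule sum.cong[OF refl])
      fix i assume "i \<in> {..r}"
      then have "(-1::'a) ^ (r - i) = (-1) ^ r * (-1) ^ i"
        by (simp add: minus_one_power_iff)
      then show "(-1) ^ (r - i) * h (int (r - i)) * e (int i)
          = (-1) ^ r * ((-1) ^ i * e (int i) * h (int (r - i)))"
        by (simp add: algebra_simps)
    qed
    also have "\<dots> = 0"
      using assms that unfolding dual_pair_def by simp
    finally show ?thesis .
  qed
  then show ?thesis using assms unfolding dual_pair_def by blast
qed

text \<open>
  The recurrence has coefficient \<open>\<plusminus> h 0 = \<plusminus> 1\<close> at \<open>e r\<close>, so it determines \<open>e r\<close> from the earlier terms.
\<close>
lemma dual_pair_unique:
  assumes "dual_pair h e" "dual_pair h e'"
  shows "e = e'"
proof -
  have nat: "e (int r) = e' (int r)" for r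
  proof (induction r rule: less_induct)
    case (less r)
    show ?case
    proof (cases "r = 0")
      case True then show ?thesis using assms by (simp add: dual_pair_def)
    next
      case False
      have split: "(\<Sum>i\<le>r. (-1) ^ i * f (int i) * h (int (r - i)))
          = (\<Sum>i<r. (-1) ^ i * f (int i) * h (int (r - i))) + (-1) ^ r * f (int r)" for f
        using assms by (simp add: dual_pair_def flip: lessThan_Suc_atMost)
      have "(\<Sum>i<r. (-1) ^ i * e (int i) * h (int (r - i)))
          = (\<Sum>i<r. (-1) ^ i * e' (int i) * h (int (r - i)))"
        using less by simp
      moreover have "(\<Sum>i\<le>r. (-1) ^ i * e (int i) * h (int (r - i)))
          = (\<Sum>i\<le>r. (-1) ^ i * e' (int i) * h (int (r - i)))"
        using assms False by (simp add: dual_pair_def)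
      ultimately have "(-1) ^ r * e (int r) = (-1) ^ r * e' (int r)"
        unfolding split by simp
      then show ?thesis by (simp add: minus_one_power_iff split: if_splits)
    qed
  qed
  show ?thesis
  proof
    fix r show "e r = e' r"
      using nat[of "nat r"] assms by (cases "r < 0") (auto simp: dual_pair_def)
  qed
qed

text \<open>
  The recurrence of a dual pair solved for its last term. The range is written as the set of a list
  so that the recursive arguments are seen to be smaller than \<open>r\<close>.
\<close>
fun dual_coeff :: "(int \<Rightarrow> 'a::comm_ring_1) \<Rightarrow> nat \<Rightarrow> 'a" where
  "dual_coeff h r = (if r = 0 then 1 else
     - ((-1) ^ r * (\<Sum>i\<in>set [0..<r]. (-1) ^ i * dual_coeff h i * h (int (r - i)))))"

declare dual_coeff.simps [simp del]

lemma dual_pair_exists: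
  assumes "h 0 = 1" "\<And>r. r < 0 \<Longrightarrow> h r = 0"
  shows "\<exists>e. dual_pair h e"
proof
  let ?e = "\<lambda>r. if r < 0 then 0 else dual_coeff h (nat r)"
  have "(\<Sum>i\<le>r. (-1) ^ i * ?e (int i) * h (int (r - i))) = 0" if "r > 0" for r
  proof -
    have "(\<Sum>i\<le>r. (-1) ^ i * ?e (int i) * h (int (r - i)))
       = (\<Sum>i<r. (-1) ^ i * dual_coeff h i * h (int (r - i))) + (-1) ^ r * dual_coeff h r"
      using assms by (simp flip: lessThan_Suc_atMost)
    also have "\<dots> = 0"
      using that by (subst (2) dual_coeff.simps) (simp add: atLeast0LessThan flip: mult.assoc power_add)
    finally show ?thesis .
  qed
  then show "dual_pair h ?e"
    using assms by (auto simp: dual_pair_def dual_coeff.simps)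
qed

section \<open>Determinants\<close>

lemma det_scale_rows_cols:
  "det (mat n n (\<lambda>(i, j). x i * y j * f i j))
    = (\<Prod>i<n. x i) * (\<Prod>j<n. y j) * det (mat n n (\<lambda>(i, j). f i j))"
proof -
  have "(\<Prod>i = 0..<n. x i * y (p i) * f i (p i)) = (\<Prod>i<n. x i) * (\<Prod>j<n. y j) * (\<Prod>i = 0..<n. f i (p i))"
    if "p permutes {0..<n}" for p
    using prod.permute[OF that, of y] by (simp add: prod.distrib atLeast0LessThan comp_def)
  then show ?thesis
    by (subst (1 2) det_def'[of _ n])
      (auto simp: sum_distrib_left mult_ac permutes_in_image intro!: sum.cong prod.cong)
qed

text \<open>
  The two signs, from the rows and from the columns, multiply to \<open>1\<close>.
\<close>
lemma det_permute_both:
  assumes A: "A \<in> carrier_mat n n" and p: "p permutes {0..<n}"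
  shows "det (mat n n (\<lambda>(i, j). A $$ (p i, p j))) = det A"
proof -
  define B where "B = mat n n (\<lambda>(i, j). A $$ (p i, j))"
  have pn: "p i < n \<longleftrightarrow> i < n" for i
    using permutes_in_image[OF p, of i] by simp
  have "det (mat n n (\<lambda>(i, j). A $$ (p i, p j))) = det (transpose_mat (mat n n (\<lambda>(i, j). A $$ (p i, p j))))"
    by (rule det_transpose[symmetric, of _ n]) auto
  also have "transpose_mat (mat n n (\<lambda>(i, j). A $$ (p i, p j))) = mat n n (\<lambda>(i, j). transpose_mat B $$ (p i, j))"
    by (rule eq_matI) (auto simp: B_def pn)
  also have "det \<dots> = signof p * det (transpose_mat B)"
    by (rule det_permute_rows[OF _ p]) (auto simp: B_def)
  also have "det (transpose_mat B) = det B"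
    by (rule det_transpose[of _ n]) (auto simp: B_def)
  also have "det B = signof p * det A"
    unfolding B_def by (rule det_permute_rows[OF A p])
  also have "signof p * (signof p * det A) = det A"
    by (simp add: sign_def)
  finally show ?thesis .
qed

text \<open>
  Subtracting \<open>x\<^sub>n\<close> times each column from the next one, which is right multiplication by the
  unitriangular matrix \<open>B\<close> below, clears the last row except for its first entry and leaves the
  factor \<open>x\<^sub>i - x\<^sub>n\<close> in each other row of the remaining minor.
\<close>
lemma det_vandermonde:
  "det (mat n n (\<lambda>(i, j). x i ^ j)) = (\<Prod>j<n. \<Prod>i<j. x j - x i :: 'a::comm_ring_1)"
proof (induction n)
  case 0
  then show ?case by simp
next
  case (Suc n)
  define V where "V = mat (Suc n) (Suc n) (\<lambda>(i, j). x i ^ j)"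
  define B where "B = mat (Suc n) (Suc n) (\<lambda>(k, j). if k = j then 1 else if Suc k = j then - x n else 0)"
  define W where "W = mat (Suc n) (Suc n) (\<lambda>(i, j). if j = 0 then 1 else x i ^ (j - 1) * (x i - x n))"
  have carr: "V \<in> carrier_mat (Suc n) (Suc n)" "B \<in> carrier_mat (Suc n) (Suc n)" "W \<in> carrier_mat (Suc n) (Suc n)"
    by (auto simp: V_def B_def W_def)
  have "V * B = W"
  proof (rule eq_matI)
    fix i j assume "i < dim_row W" "j < dim_col W"
    then have i: "i < Suc n" and j: "j < Suc n" by (auto simp: W_def)
    have "(V * B) $$ (i, j)
        = (\<Sum>k<Suc n. x i ^ k * (if k = j then 1 else if Suc k = j then - x n else 0))"
      using i j by (auto simp: scalar_prod_def V_def B_def atLeast0LessThan intro!: sum.cong)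
    also have "\<dots> = (\<Sum>k<Suc n. (if k = j then x i ^ k else 0) + (if Suc k = j then - (x i ^ k * x n) else 0))"
      by (intro sum.cong) auto
    also have "\<dots> = x i ^ j + (\<Sum>k<Suc n. if Suc k = j then - (x i ^ k * x n) else 0)"
      using j by (simp only: sum.distrib) (simp add: sum.delta)
    also have "(\<Sum>k<Suc n. if Suc k = j then - (x i ^ k * x n) else 0) =
        (if j = 0 then 0 else - (x i ^ (j - 1) * x n))"
    proof (cases j)
      case (Suc j')
      then have "(\<Sum>k<Suc n. if Suc k = j then - (x i ^ k * x n) else 0)
        = (\<Sum>k<Suc n. if k = j' then - (x i ^ k * x n) else 0)" by simp
      also have "\<dots> = - (x i ^ j' * x n)"
        using Suc j by (subst sum.delta) auto
      finally show ?thesis using Suc by simp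
    qed simp
    also have "x i ^ j + (if j = 0 then 0 else - (x i ^ (j - 1) * x n)) = W $$ (i, j)"
      using i j by (cases j) (auto simp: W_def algebra_simps)
    finally show "(V * B) $$ (i, j) = W $$ (i, j)" .
  qed (use carr in auto)
  moreover have "det B = 1"
  proof -
    have "det B = prod_list (diag_mat B)"
      using carr by (intro det_upper_triangular) (auto simp: B_def)
    also have "diag_mat B = map (\<lambda>_. 1) [0..<Suc n]"
      by (auto simp: diag_mat_def B_def)
    finally show ?thesis by (simp add: map_replicate_const del: upt_Suc)
  qed
  ultimately have "det V = det W"
    using det_mult[OF carr(1,2)] by simp
  also have "\<dots> = (\<Sum>j<Suc n. W $$ (n, j) * cofactor W n j)"
    by (rule laplace_expansion_row[OF carr(3)]) simp
  also have "\<dots> = (\<Sum>j<Suc n. if j = 0 then cofactor W n 0 else 0)"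
    by (intro sum.cong) (auto simp: W_def)
  also have "\<dots> = (-1) ^ n * det (mat_delete W n 0)"
    by (simp add: cofactor_def)
  also have "mat_delete W n 0 = mat n n (\<lambda>(i, j). (x i - x n) * 1 * x i ^ j)"
    by (rule eq_matI) (auto simp: mat_delete_def W_def)
  also have "det \<dots> = (\<Prod>i<n. x i - x n) * (\<Prod>j<n. \<Prod>i<j. x j - x i)"
    by (subst det_scale_rows_cols) (simp add: Suc)
  also have "(-1) ^ n * ((\<Prod>i<n. x i - x n) * (\<Prod>j<n. \<Prod>i<j. x j - x i))
      = (\<Prod>j<Suc n. \<Prod>i<j. x j - x i)"
    using prod_uminus[of "\<lambda>i. x i - x n" "{..<n}"] by (simp add: mult_ac)
  finally show ?case by (simp add: V_def)
qed

section \<open>Complementary minors of Toeplitz matrices\<close>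

text \<open>
  An entry of the product of the two triangular Toeplitz matrices: only \<open>a \<le> c \<le> b\<close> contributes, and
  that part of the sum is the recurrence of a dual pair at \<open>r = b - a\<close>.
\<close>
lemma toeplitz_inverse:
  assumes "dual_pair h e" "a < N" "b < N"
  shows "(\<Sum>c<N. h (int c - int a) * ((-1) ^ (b + c) * e (int b - int c))) = (if a = b then 1 else 0)"
proof -
  have neg: "h r = 0" "e r = 0" if "r < 0" for r
    using assms that by (auto simp: dual_pair_def)
  have "(\<Sum>c<N. h (int c - int a) * ((-1) ^ (b + c) * e (int b - int c)))
      = (\<Sum>c\<in>{a..b}. h (int c - int a) * ((-1) ^ (b + c) * e (int b - int c)))"
    by (rule sum.mono_neutral_right) (use assms neg in \<open>auto simp: not_le\<close>)
  also have "\<dots> = (if a = b then 1 else 0)"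
  proof (cases "a \<le> b")
    case False
    then show ?thesis by simp
  next
    case True
    have "(\<Sum>c\<in>{a..b}. h (int c - int a) * ((-1) ^ (b + c) * e (int b - int c)))
       = (\<Sum>i\<le>b - a. (-1) ^ i * e (int i) * h (int (b - a - i)))"
    proof (rule sum.reindex_bij_witness[of _ "\<lambda>i. b - i" "\<lambda>c. b - c"])
      fix c assume c: "c \<in> {a..b}"
      then have "(-1::'a) ^ (b + c) = (-1) ^ (b - c)"
        by (simp add: minus_one_power_iff)
      moreover have "int (b - a - (b - c)) = int c - int a" "int (b - c) = int b - int c"
        using c by auto
      ultimately show "(-1) ^ (b - c) * e (int (b - c)) * h (int (b - a - (b - c)))
          = h (int c - int a) * ((-1) ^ (b + c) * e (int b - int c))"
        by (simp add: mult_ac)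
    qed (use True in auto)
    also have "\<dots> = (if a = b then 1 else 0)"
      using dual_pair_recurrence[OF assms(1), of "b - a"] assms(1) True
      by (cases "a = b") (auto simp: dual_pair_def simp del: of_nat_diff)
    finally show ?thesis .
  qed
  finally show ?thesis .
qed

text \<open>
  A case of Jacobi's theorem on complementary minors. Let \<open>M\<close> be the Toeplitz matrix \<open>H\<close> of \<open>h\<close> with its
  rows permuted by \<open>p\<close>, and let \<open>X\<close> consist of the first \<open>m\<close> columns of \<open>M\<inverse>\<close> followed by the last \<open>n\<close>
  unit vectors. Then \<open>M * X\<close> and \<open>X\<close> are both block triangular, with an identity block each, so that
  \<open>det M * det X = det (M * X)\<close> becomes the asserted equation between the two other diagonal blocks.
\<close>
lemma toeplitz_complementary_minors:
  fixes h e :: "int \<Rightarrow> 'a::idom"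
  assumes dual: "dual_pair h e" and p: "p permutes {0..<m + n}"
  shows "det (mat n n (\<lambda>(i, j). h (int (m + j) - int (p (m + i)))))
    = signof p * det (mat m m (\<lambda>(i, j). (-1) ^ (p j + i) * e (int (p j) - int i)))"
proof -
  let ?N = "m + n"
  define H where "H = mat ?N ?N (\<lambda>(r, c). h (int c - int r))"
  define M where "M = mat ?N ?N (\<lambda>(r, c). H $$ (p r, c))"
  define D where "D = mat n n (\<lambda>(i, j). h (int (m + j) - int (p (m + i))))"
  define E where "E = mat m m (\<lambda>(i, j). (-1) ^ (p j + i) * e (int (p j) - int i))"
  define E2 where "E2 = mat n m (\<lambda>(i, j). (-1) ^ (p j + (m + i)) * e (int (p j) - int (m + i)))"
  define D2 where "D2 = mat m n (\<lambda>(i, j). h (int (m + j) - int (p i)))"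
  define X where "X = four_block_mat E (0\<^sub>m m n) E2 (1\<^sub>m n)"
  have carr: "H \<in> carrier_mat ?N ?N" "M \<in> carrier_mat ?N ?N" "D \<in> carrier_mat n n"
      "E \<in> carrier_mat m m" "E2 \<in> carrier_mat n m" "D2 \<in> carrier_mat m n" "X \<in> carrier_mat ?N ?N"
    by (auto simp: H_def M_def D_def E_def E2_def D2_def X_def)
  have pN: "p r < ?N" if "r < ?N" for r
    using permutes_in_image[OF p, of r] that by simp
  have pinj: "p a = p b \<longleftrightarrow> a = b" for a b
    using permutes_inj[OF p] by (auto dest: injD)
  have detH: "det H = 1"
  proof -
    have "upper_triangular H"
      using dual by (auto simp: H_def dual_pair_def)
    then have "det H = prod_list (diag_mat H)"
      using carr by (intro det_upper_triangular)
    also have "diag_mat H = map (\<lambda>_. 1) [0..<?N]"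
      using dual by (auto simp: diag_mat_def H_def dual_pair_def)
    finally show ?thesis by (simp add: prod_list_replicate map_replicate_const)
  qed
  have detM: "det M = signof p"
    unfolding M_def using det_permute_rows[OF carr(1) p] detH by simp
  have detX: "det X = det E"
    unfolding X_def using carr by (subst det_four_block_mat_upper_right_zero) auto
  have "M * X = four_block_mat (1\<^sub>m m) D2 (0\<^sub>m n m) D"
  proof (rule eq_matI)
    fix r k
    assume "r < dim_row (four_block_mat (1\<^sub>m m) D2 (0\<^sub>m n m) D)"
      "k < dim_col (four_block_mat (1\<^sub>m m) D2 (0\<^sub>m n m) D)"
    then have r: "r < ?N" and k: "k < ?N" by (auto simp: D_def)
    have "(M * X) $$ (r, k) = (\<Sum>c<?N. h (int c - int (p r)) * X $$ (c, k))"
      using r k carr pN[OF r] by (auto simp: scalar_prod_def M_def H_def atLeast0LessThan intro!: sum.cong)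
    also have "\<dots> = four_block_mat (1\<^sub>m m) D2 (0\<^sub>m n m) D $$ (r, k)"
    proof (cases "k < m")
      case True
      then have "X $$ (c, k) = (-1) ^ (p k + c) * e (int (p k) - int c)" if "c < ?N" for c
        using that by (auto simp: X_def E_def E2_def of_nat_diff)
      then have "(\<Sum>c<?N. h (int c - int (p r)) * X $$ (c, k))
         = (\<Sum>c<?N. h (int c - int (p r)) * ((-1) ^ (p k + c) * e (int (p k) - int c)))"
        by simp
      also have "\<dots> = (if r = k then 1 else 0)"
        using toeplitz_inverse[OF dual pN[OF r] pN[OF k]] pinj by simp
      also have "\<dots> = four_block_mat (1\<^sub>m m) D2 (0\<^sub>m n m) D $$ (r, k)"
        using True r k by (auto simp: D_def)
      finally show ?thesis .
    next
      case False
      then have "X $$ (c, k) = (if c = k then 1 else 0)" if "c < ?N" for c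
        using that k by (auto simp: X_def E_def E2_def)
      then have "(\<Sum>c<?N. h (int c - int (p r)) * X $$ (c, k))
         = (\<Sum>c<?N. if c = k then h (int c - int (p r)) else 0)"
        by (intro sum.cong) auto
      also have "\<dots> = h (int k - int (p r))"
        using k by simp
      also have "\<dots> = four_block_mat (1\<^sub>m m) D2 (0\<^sub>m n m) D $$ (r, k)"
        using False r k by (auto simp: D_def D2_def of_nat_diff)
      finally show ?thesis .
    qed
    finally show "(M * X) $$ (r, k) = four_block_mat (1\<^sub>m m) D2 (0\<^sub>m n m) D $$ (r, k)" .
  qed (use carr in auto)
  then have "det M * det X = det D"
    using carr by (simp flip: det_mult) (subst det_four_block_mat_lower_left_zero, auto)
  then show ?thesis using detM detX by (simp add: D_def E_def)
qed

text \<open>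
  A permutation increasing on \<open>{..<m}\<close> and on \<open>{m..<m + n}\<close> has \<open>\<Sum>\<^bsub>k<m\<^esub> (p k - k)\<close> inversions; the sum \<open>p k + k\<close>
  has the same parity and avoids subtraction. The proof sorts \<open>p\<close> by adjacent transpositions: if \<open>k\<close>
  is the first place in the first run with \<open>p k > k\<close>, then the value \<open>p k - 1\<close> lies in the second run,
  and exchanging the values \<open>p k - 1\<close> and \<open>p k\<close> keeps both runs increasing and lowers the sum by one.
\<close>
lemma sign_two_runs:
  assumes "p permutes {0..<m + n}" "strict_mono_on {..<m} p" "strict_mono_on {m..<m + n} p"
  shows "sign p = (-1) ^ (\<Sum>k<m. p k + k)"
  using assms
proof (induction "\<Sum>k<m. p k + k" arbitrary: p rule: less_induct)
  case less
  note p = less.prems(1)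
  have lo: "p i < p j" if "i < j" "j < m" for i j
    using strict_mono_onD[OF less.prems(2), of i j] that by simp
  have hi: "p i < p j" if "m \<le> i" "i < j" "j < m + n" for i j
    using strict_mono_onD[OF less.prems(3), of i j] that by simp
  have pinj: "p a = p b \<longleftrightarrow> a = b" for a b
    using permutes_inj[OF p] by (auto dest: injD)
  show ?case
  proof (cases "\<forall>k<m. p k = k")
    case True
    \<comment> \<open>An increasing map on the second run that avoids \<open>{..<m}\<close> cannot move a point down.\<close>
    have "p i \<ge> i" if "m \<le> i" "i < m + n" for i
      using that
    proof (induction i rule: dec_induct)
      case base
      then show ?case using True pinj by (metis not_le_imp_less order_less_irrefl)
    next
      case (step i)
      then show ?case using hi[of i "Suc i"] by simp
    qed
    then have "\<forall>i\<in>{0..<m + n}. p i \<ge> i"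
      using True by (metis atLeastLessThan_iff linorder_not_le order_refl)
    then have "p = id"
      using permutes_natset_ge[OF p] by blast
    then show ?thesis by (simp add: power_sum power_add flip: power_mult_distrib)
  next
    case False
    define k where "k = (LEAST k. k < m \<and> p k \<noteq> k)"
    have k: "k < m" "p k \<noteq> k"
      using False LeastI_ex[of "\<lambda>k. k < m \<and> p k \<noteq> k"] unfolding k_def by blast+
    have below: "p j = j" if "j < k" for j
    proof -
      have "\<not> (j < m \<and> p j \<noteq> j)"
        using that unfolding k_def by (rule not_less_Least)
      then show ?thesis using that k(1) by simp
    qed
    have gt: "p k > k"
      using below[of "p k"] pinj[of "p k" k] k(2) by force
    define a where "a = p k - 1"
    have pk: "p k = Suc a" and ka: "k \<le> a" using gt by (auto simp: a_def)
    obtain l where pl: "p l = a" using permutes_surj[OF p] by (metis surjD)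
    have "p k < m + n" using permutes_in_image[OF p, of k] k(1) by simp
    then have lN: "l < m + n" using permutes_in_image[OF p, of l] pl pk by simp
    have lm: "m \<le> l"
    proof (rule ccontr)
      assume "\<not> m \<le> l"
      then show False
        using below[of l] lo[of k l] pl pk ka
        by (metis Suc_n_not_le_n less_imp_le linorder_neqE_nat not_le)
    qed
    define q where "q = transpose a (Suc a) \<circ> p"
    have qk: "q k = a" and ql: "q l = Suc a"
      by (simp_all add: q_def pk pl)
    have q: "q j = p j" if "j \<noteq> k" "j \<noteq> l" for j
      using that pinj[of j k] pinj[of j l] by (simp add: q_def pk pl transpose_def)
    have SaN: "Suc a < m + n" using \<open>p k < m + n\<close> pk by simp
    have qperm: "q permutes {0..<m + n}"
      unfolding q_def using SaN by (intro permutes_compose[OF p] permutes_swap_id) auto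
    have qlo: "strict_mono_on {..<m} q"
    proof (rule strict_mono_onI)
      fix i j assume ij: "i \<in> {..<m}" "j \<in> {..<m}" "i < j"
      then have nl: "i \<noteq> l" "j \<noteq> l" using lm by auto
      consider "j = k" | "i = k" | "i \<noteq> k" "j \<noteq> k" by blast
      then show "q i < q j"
      proof cases
        case 1
        then show ?thesis using ij nl below[of i] q[of i] qk ka by simp
      next
        case 2
        then show ?thesis using ij nl lo[of k j] q[of j] qk pk by simp
      next
        case 3
        then show ?thesis using ij nl lo[of i j] q by simp
      qed
    qed
    have qhi: "strict_mono_on {m..<m + n} q"
    proof (rule strict_mono_onI)
      fix i j assume ij: "i \<in> {m..<m + n}" "j \<in> {m..<m + n}" "i < j"
      then have nk: "i \<noteq> k" "j \<noteq> k" using k(1) by auto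
      consider "j = l" | "i = l" | "i \<noteq> l" "j \<noteq> l" by blast
      then show "q i < q j"
      proof cases
        case 1
        then show ?thesis using ij nk hi[of i l] q[of i] ql pl by simp
      next
        case 2
        have "p j \<noteq> Suc a" using pinj[of j k] nk pk by simp
        then show ?thesis using 2 ij nk hi[of l j] q[of j] ql pl by simp
      next
        case 3
        then show ?thesis using ij nk hi[of i j] q by simp
      qed
    qed
    have "(\<Sum>j\<in>{..<m} - {k}. q j + j) = (\<Sum>j\<in>{..<m} - {k}. p j + j)"
      using lm q by (intro sum.cong) auto
    then have sum: "(\<Sum>j<m. p j + j) = Suc (\<Sum>j<m. q j + j)"
      using k(1) by (simp add: sum.remove[of "{..<m}" k] qk pk)
    have "sign q = (-1) ^ (\<Sum>k<m. q k + k)"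
      using less.hyps[OF _ qperm qlo qhi] sum by simp
    moreover have "sign q = - sign p"
      unfolding q_def using p
      by (subst sign_compose) (auto simp: sign_swap_id permutation_swap_id intro: permutation_permutes[THEN iffD2])
    ultimately show ?thesis unfolding sum by simp
  qed
qed

section \<open>The dual Jacobi-Trudi identity\<close>

definition jacobi_trudi :: "(int \<Rightarrow> 'a::comm_ring_1) \<Rightarrow> (nat \<Rightarrow> int) \<Rightarrow> nat \<Rightarrow> 'a" where
  "jacobi_trudi h a n = det (mat n n (\<lambda>(i, j). h (a i + int j - int i)))"

lemma mem_initial_segment_iff:
  fixes A :: "nat set"
  assumes "finite A" "\<And>i j. j \<in> A \<Longrightarrow> i \<le> j \<Longrightarrow> i \<in> A"
  shows "i \<in> A \<longleftrightarrow> i < card A"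
proof (cases "A = {}")
  case False
  then have "Max A \<in> A" using assms(1) by simp
  then have "x \<in> A \<longleftrightarrow> x < Suc (Max A)" for x
    using assms(1) assms(2)[of "Max A" x] Max_ge[of A x] by (metis less_Suc_eq_le)
  then have "A = {..<Suc (Max A)}" by blast
  then obtain k where "A = {..<k}" ..
  then show ?thesis by simp
qed simp

lemma partition_antimono:
  assumes "is_partition l" "i \<le> j" shows "entry l j \<le> entry l i"
  using assms(2,1) by (induction rule: dec_induct) (simp_all add: is_partition_def, meson order_trans)

lemma partition_nonneg: "is_partition l \<Longrightarrow> entry l i \<ge> 0"
  unfolding is_partition_def by (meson order_trans)

text \<open>
  Both sides say that the box in row \<open>i\<close> and column \<open>k\<close> belongs to the Young diagram of \<open>l\<close>.
\<close>
lemma entry_conjugate_iff: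
  assumes "is_partition l"
  shows "int i < entry (conjugate l) k \<longleftrightarrow> int k < entry l i"
proof -
  define A where "A = {j. entry l j \<ge> int (k + 1)}"
  have "A \<subseteq> Poly_Mapping.keys l" by (auto simp: A_def in_keys_iff)
  then have "finite A" by (rule finite_subset) simp
  then have "i \<in> A \<longleftrightarrow> i < card A"
  proof (rule mem_initial_segment_iff)
    fix i j assume "j \<in> A" "i \<le> j"
    then show "i \<in> A"
      using partition_antimono[OF assms, of i j] by (simp add: A_def)
  qed
  moreover have "entry (conjugate l) k = int (card A)"
    by (simp add: conjugate.rep_eq A_def)
  ultimately show ?thesis by (auto simp: A_def)
qed

lemma reverse_permutes: "(\<lambda>i. if i < m then m - 1 - i else i) permutes {0..<m::nat}"
proof (rule bij_imp_permutes)
  show "bij_betw (\<lambda>i. if i < m then m - 1 - i else i) {0..<m} {0..<m}"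
    by (rule bij_betw_byWitness[where f' = "\<lambda>i. m - 1 - i"]) auto
qed auto

text \<open>
  The numbers \<open>m + i - \<lambda>\<^sub>i\<close> for \<open>i < n\<close> and \<open>m - 1 - k + \<lambda>'\<^sub>k\<close> for \<open>k < m\<close> label the two kinds of steps on the
  boundary path of the diagram of \<open>\<lambda>\<close> inside an \<open>n\<close> by \<open>m\<close> box, so together they are \<open>0, \<dots>, m + n - 1\<close>. The
  permutation \<open>p\<close> lists the second kind and then the first, each in increasing order, and
  \<open>toeplitz_complementary_minors\<close> for \<open>p\<close> relates the two determinants.
\<close>
lemma dual_jacobi_trudi:
  fixes h e :: "int \<Rightarrow> 'a::idom"
  assumes dual: "dual_pair h e" and part: "is_partition l"
    and n: "entry l n = 0" and m: "entry l 0 \<le> int m"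
  shows "jacobi_trudi h (entry l) n = jacobi_trudi e (entry (conjugate l)) m"
proof -
  define a where "a i = nat (entry l i)" for i
  define c where "c k = nat (entry (conjugate l) k)" for k
  have a: "entry l i = int (a i)" for i
    using partition_nonneg[OF part] by (simp add: a_def)
  have c: "entry (conjugate l) k = int (c k)" for k
    by (simp add: c_def conjugate.rep_eq)
  have key: "i < c k \<longleftrightarrow> k < a i" for i k
    using entry_conjugate_iff[OF part, of i k] by (simp add: a c)
  have a_anti: "a j \<le> a i" if "i \<le> j" for i j
    using partition_antimono[OF part that] by (simp add: a)
  have c_anti: "c j \<le> c i" if "i \<le> j" for i j
    using key[of "c i" j] key[of "c i" i] that by (cases "c i < c j") auto
  have am: "a i \<le> m" for i using a_anti[of 0 i] m by (simp add: a)
  have cn: "c k \<le> n" for k using key[of n k] n by (simp add: a)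
  define p where "p r = (if r < m then r + c (m - 1 - r) else if r < m + n then r - a (r - m) else r)" for r
  have lo: "strict_mono_on {..<m} p"
    using c_anti by (auto intro!: strict_mono_onI add_less_le_mono simp: p_def)
  have hi: "strict_mono_on {m..<m + n} p"
  proof (rule strict_mono_onI)
    fix r s assume rs: "r \<in> {m..<m + n}" "s \<in> {m..<m + n}" "r < s"
    then have "a (s - m) \<le> a (r - m)" by (intro a_anti) auto
    then show "p r < p s" using rs am[of "r - m"] by (auto simp: p_def)
  qed
  \<comment> \<open>Row label \<open>i\<close> equals column label \<open>k\<close> only if \<open>\<lambda>\<^sub>i + \<lambda>'\<^sub>k = i + k + 1\<close>, but the sum is larger if
    box \<open>(i, k)\<close> is in the diagram and smaller if it is not.\<close>
  have disj: "p r \<noteq> p s" if "r < m" "m \<le> s" "s < m + n" for r s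
    using key[of "s - m" "m - 1 - r"] that am[of "s - m"] by (auto simp: p_def)
  have inj: "inj_on p {0..<m + n}"
  proof (rule linorder_inj_onI)
    fix r s assume "r < s" "r \<in> {0..<m + n}" "s \<in> {0..<m + n}"
    then show "p r \<noteq> p s"
      using disj[of r s] strict_mono_onD[OF lo, of r s] strict_mono_onD[OF hi, of r s]
      by (cases "s < m"; cases "r < m") auto
  qed auto
  have "p ` {0..<m + n} \<subseteq> {0..<m + n}"
  proof (rule image_subsetI)
    fix r assume "r \<in> {0..<m + n}"
    then show "p r \<in> {0..<m + n}" using cn[of "m - 1 - r"] by (auto simp: p_def)
  qed
  then have "bij_betw p {0..<m + n} {0..<m + n}"
    using inj by (simp add: bij_betw_def endo_inj_surj)
  then have perm: "p permutes {0..<m + n}"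
    by (rule bij_imp_permutes) (auto simp: p_def)
  define E where "E = mat m m (\<lambda>(i, j). e (int (p j) - int i))"
  define C where "C = mat m m (\<lambda>(i, j). e (entry (conjugate l) i + int j - int i))"
  have top: "entry l i + int j - int i = int (m + j) - int (p (m + i))" if "i < n" for i j
  proof -
    have "a i \<le> m + i" using am[of i] by simp
    then show ?thesis using that by (simp add: p_def a of_nat_diff)
  qed
  have "jacobi_trudi h (entry l) n = det (mat n n (\<lambda>(i, j). h (int (m + j) - int (p (m + i)))))"
    unfolding jacobi_trudi_def
    by (rule arg_cong[of _ _ det], rule cong_mat) (simp_all add: top)
  also have "\<dots> = signof p * det (mat m m (\<lambda>(i, j). (-1) ^ (p j + i) * e (int (p j) - int i)))"
    by (rule toeplitz_complementary_minors[OF dual perm])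
  also have "mat m m (\<lambda>(i, j). (-1) ^ (p j + i) * e (int (p j) - int i))
      = mat m m (\<lambda>(i, j). (-1) ^ i * (-1) ^ p j * e (int (p j) - int i))"
    by (rule cong_mat) (auto simp: power_add)
  also have "det \<dots> = (\<Prod>i<m. (-1) ^ i) * (\<Prod>j<m. (-1) ^ p j) * det E"
    unfolding E_def by (rule det_scale_rows_cols)
  \<comment> \<open>The sign of \<open>p\<close> and the signs in the inverse Toeplitz matrix have the same parity.\<close>
  also have "signof p = ((\<Prod>i<m. (-1) ^ i) * (\<Prod>j<m. (-1) ^ p j) :: 'a)"
    by (simp add: sign_two_runs[OF perm lo hi] power_sum power_add prod.distrib mult.commute)
  also have "\<dots> * (\<dots> * det E) = det E"
    by (simp add: mult_ac flip: prod.distrib power_add power_mult_distrib)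
  also have "det E = det (transpose_mat E)"
    by (rule det_transpose[symmetric, of _ m]) (simp add: E_def)
  \<comment> \<open>The first run of \<open>p\<close> lists the columns of \<open>\<lambda>\<close> backwards, so both indices are reversed.\<close>
  also have "transpose_mat E
     = mat m m (\<lambda>(i, j). C $$ (if i < m then m - 1 - i else i, if j < m then m - 1 - j else j))"
    by (rule eq_matI) (auto simp: E_def C_def p_def c of_nat_diff algebra_simps)
  also have "det \<dots> = det C"
    by (rule det_permute_both[OF _ reverse_permutes]) (simp add: C_def)
  also have "\<dots> = jacobi_trudi e (entry (conjugate l)) m"
    by (simp add: C_def jacobi_trudi_def)
  finally show ?thesis .
qed

section \<open>Raising operators and determinants\<close>

lemma single_sum: "(\<Prod>i\<in>A. Poly_Mapping.single (g i) 1)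
    = (Poly_Mapping.single (\<Sum>i\<in>A. g i) 1 :: 'b::comm_monoid_add \<Rightarrow>\<^sub>0 'a::comm_semiring_1)"
  by (induction A rule: infinite_finite_induct) (simp_all add: mult_single)

lemma raising_eq_add:
  "finite S \<Longrightarrow> raising S \<alpha>
    = \<alpha> + (\<Sum>(i, j)\<in>S. Poly_Mapping.single i 1 - Poly_Mapping.single j 1)"
  by (induction S rule: finite_induct) (auto simp: raising_empty raising_insert R_def algebra_simps)

text \<open>
  With \<open>Y\<^sub>i = 1 / X\<^sub>i\<close> the left side is \<open>\<Prod>\<^sub>j Y\<^sub>j\<^sup>j\<close> times the Vandermonde product of the \<open>X\<^sub>i\<close>, hence the
  determinant of the matrix \<open>(X\<^sub>i\<^bsup>j - i\<^esup>)\<close>.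
\<close>
lemma raising_product_eq_det:
  fixes X Y :: "nat \<Rightarrow> 'a::comm_ring_1"
  assumes "\<And>i. X i * Y i = 1"
  shows "(\<Prod>(i, j)\<in>{(i, j). i < j \<and> j < n}. 1 - X i * Y j)
    = (\<Sum>\<pi> | \<pi> permutes {0..<n}. signof \<pi> * (\<Prod>i<n. Y i ^ i * X i ^ \<pi> i))"
proof -
  have "(\<Prod>(i, j)\<in>{(i, j). i < j \<and> j < n}. 1 - X i * Y j) = (\<Prod>(j, i)\<in>(SIGMA j:{..<n}. {..<j}). 1 - X i * Y j)"
    by (rule prod.reindex_bij_witness[of _ prod.swap prod.swap]) auto
  also have "\<dots> = (\<Prod>j<n. \<Prod>i<j. 1 - X i * Y j)"
    by (rule prod.Sigma[symmetric]) auto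
  also have "\<dots> = (\<Prod>j<n. \<Prod>i<j. Y j * (X j - X i))"
    using assms by (simp add: algebra_simps)
  also have "\<dots> = (\<Prod>j<n. Y j ^ j) * det (mat n n (\<lambda>(i, j). X i ^ j))"
    by (simp add: prod.distrib det_vandermonde)
  also have "\<dots> = det (mat n n (\<lambda>(i, j). Y i ^ i * X i ^ j))"
    using det_scale_rows_cols[of n "\<lambda>i. Y i ^ i" "\<lambda>_. 1" "\<lambda>i j. X i ^ j"] by simp
  also have "\<dots> = (\<Sum>\<pi> | \<pi> permutes {0..<n}. signof \<pi> * (\<Prod>i<n. Y i ^ i * X i ^ \<pi> i))"
    by (subst det_def'[of _ n]) (auto simp: atLeast0LessThan permutes_in_image intro!: sum.cong prod.cong)
  finally show ?thesis .
qed

lemma frag_cmul_eq_mult: "frag_cmul k x = of_int k * (x :: 'b::comm_monoid_add \<Rightarrow>\<^sub>0 int)"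
proof (induction k rule: int_induct[where k = 0])
  case (step1 i)
  then show ?case by (simp add: frag_cmul_distrib algebra_simps)
next
  case (step2 i)
  then show ?case by (simp add: frag_cmul_diff_distrib algebra_simps)
qed simp

text \<open>
  Needed because the signs in the expansions are elements \<open>\<plusminus> 1\<close> of the group algebra, whereas
  \<open>frag_extend\<close> is linear for the scalar action \<open>frag_cmul\<close>.
\<close>
lemma frag_extend_of_int_mult:
  fixes f :: "'b::comm_monoid_add \<Rightarrow> 'c::comm_monoid_add \<Rightarrow>\<^sub>0 int"
  shows "frag_extend f (of_int k * x) = of_int k * frag_extend f x"
  using frag_extend_cmul[of f k x] by (simp add: frag_cmul_eq_mult)

lemma finitely_many_nonzero_entries:
  "\<exists>n. \<forall>k\<ge>n. entry \<alpha> k = 0"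
proof -
  obtain n where "\<forall>k\<in>Poly_Mapping.keys \<alpha>. k < n"
    using finite_nat_set_iff_bounded[of "Poly_Mapping.keys \<alpha>"] by auto
  then have "entry \<alpha> k = 0" if "k \<ge> n" for k
    using that by (meson in_keys_iff not_le)
  then show ?thesis by blast
qed

lemma u_seq_eq_prod:
  assumes "\<And>k. k \<ge> n \<Longrightarrow> entry \<alpha> k = 0"
  shows "u_seq \<alpha> = (\<Prod>i<n. u (entry \<alpha> i))"
  unfolding u_seq_def
proof (rule Prod_any.expand_superset)
  show "{i. u (entry \<alpha> i) \<noteq> 1} \<subseteq> {..<n}"
  proof
    fix i assume "i \<in> {i. u (entry \<alpha> i) \<noteq> 1}"
    then show "i \<in> {..<n}" using assms[of i] by (cases "i < n") (auto simp: u_def)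
  qed
qed simp

lemma lookup_sum_single:
  fixes n k :: nat
  shows "Poly_Mapping.lookup (\<Sum>i<n. Poly_Mapping.single i (f i)) k = (if k < n then f k else 0)"
  by (induction n) (auto simp: lookup_add lookup_single when_def less_Suc_eq)

text \<open>
  Only finitely many sets of raising operators contribute to \<open>U \<alpha>\<close>, so for large \<open>n\<close> they all involve
  indices below \<open>n\<close> only and come from the expansion of the finite product over \<open>i < j < n\<close>.
\<close>
lemma U_eq_jacobi_trudi: "\<exists>n0. \<forall>n\<ge>n0. U \<alpha> = jacobi_trudi u (entry \<alpha>) n"
proof -
  obtain n1 where n1: "\<And>k. k \<ge> n1 \<Longrightarrow> entry \<alpha> k = 0"
    using finitely_many_nonzero_entries by blast
  define T where "T = {S. U_summand \<alpha> S \<noteq> 0}"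
  have T: "finite S" "S \<subseteq> index_pairs" if "S \<in> T" for S
    using that by (auto simp: T_def U_summand_def split: if_splits)
  have "finite (snd ` \<Union>T)"
    using T(1) finite_U_summand[of \<alpha>] by (auto simp: T_def)
  then have "\<exists>n2. \<forall>j\<in>snd ` \<Union>T. j < n2"
    by (rule finite_nat_set_iff_bounded[THEN iffD1])
  then obtain n2 where n2: "\<And>j. j \<in> snd ` \<Union>T \<Longrightarrow> j < n2"
    by blast
  have "U \<alpha> = jacobi_trudi u (entry \<alpha>) n" if n: "n \<ge> max n1 n2" for n
  proof -
    define P where "P = {(i, j). i < j \<and> j < n}"
    define X :: "nat \<Rightarrow> intseq \<Rightarrow>\<^sub>0 int"
      where "X i = Poly_Mapping.single (Poly_Mapping.single i 1) 1" for i
    define Y :: "nat \<Rightarrow> intseq \<Rightarrow>\<^sub>0 int"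
      where "Y i = Poly_Mapping.single (Poly_Mapping.single i (-1)) 1" for i
    \<comment> \<open>\<open>X i\<close> and \<open>Y i\<close> are \<open>x\<^sub>i\<close> and \<open>1 / x\<^sub>i\<close>; the map \<open>\<Phi>\<close> is \<open>x\<^sup>\<beta> \<mapsto> u\<^bsub>\<alpha> + \<beta>\<^esub>\<close>.\<close>
    define \<Phi> where "\<Phi> x = frag_extend u_seq (frag_of \<alpha> * x)" for x
    have \<Phi>_sum: "\<Phi> (\<Sum>i\<in>I. of_int (k i) * x i) = (\<Sum>i\<in>I. of_int (k i) * \<Phi> (x i))"
      if "finite I" for I :: "'i set" and k x
    proof -
      have "\<Phi> (\<Sum>i\<in>I. of_int (k i) * x i) = frag_extend u_seq (\<Sum>i\<in>I. of_int (k i) * (frag_of \<alpha> * x i))"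
        by (simp add: \<Phi>_def sum_distrib_left mult.left_commute)
      also have "\<dots> = (\<Sum>i\<in>I. of_int (k i) * \<Phi> (x i))"
        using that by (simp add: frag_extend_sum frag_extend_of_int_mult \<Phi>_def)
      finally show ?thesis .
    qed
    have \<Phi>_single: "\<Phi> (Poly_Mapping.single \<beta> 1) = u_seq (\<alpha> + \<beta>)" for \<beta>
      by (simp add: \<Phi>_def mult_single)
    have finP: "finite P"
      by (rule finite_subset[of _ "{..<n} \<times> {..<n}"]) (auto simp: P_def)
    have "T \<subseteq> Pow P"
    proof safe
      fix S i j assume S: "S \<in> T" "(i, j) \<in> S"
      then have "j < n2" using n2[of j] by force
      then show "(i, j) \<in> P" using S T(2)[of S] n by (auto simp: P_def index_pairs_def)
    qed
    then have "U \<alpha> = (\<Sum>S\<in>Pow P. U_summand \<alpha> S)"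
      unfolding U_def T_def using finP by (intro Sum_any.expand_superset) auto
    also have "\<dots> = (\<Sum>S\<in>Pow P. of_int ((-1) ^ card S) * \<Phi> (\<Prod>(i, j)\<in>S. X i * Y j))"
    proof (rule sum.cong[OF refl])
      fix S assume "S \<in> Pow P"
      then have S: "finite S" "S \<subseteq> index_pairs"
        using finP by (auto simp: P_def index_pairs_def intro: finite_subset)
      have "(\<Prod>(i, j)\<in>S. X i * Y j)
          = (\<Prod>p\<in>S. Poly_Mapping.single (case p of (i, j) \<Rightarrow> Poly_Mapping.single i 1 - Poly_Mapping.single j 1) 1)"
        by (rule prod.cong) (auto simp: X_def Y_def mult_single single_uminus)
      then have "(\<Prod>(i, j)\<in>S. X i * Y j)
          = Poly_Mapping.single (\<Sum>(i, j)\<in>S. Poly_Mapping.single i 1 - Poly_Mapping.single j 1) 1"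
        by (simp only: single_sum)
      then have "\<Phi> (\<Prod>(i, j)\<in>S. X i * Y j) = u_seq (raising S \<alpha>)"
        by (simp only: \<Phi>_single raising_eq_add[OF S(1)])
      then show "U_summand \<alpha> S = of_int ((-1) ^ card S) * \<Phi> (\<Prod>(i, j)\<in>S. X i * Y j)"
        using S by (simp add: U_summand_def)
    qed
    also have "\<dots> = \<Phi> (\<Sum>S\<in>Pow P. of_int ((-1) ^ card S) * (\<Prod>(i, j)\<in>S. X i * Y j))"
      using finP by (simp only: \<Phi>_sum finite_Pow_iff)
    also have "(\<Sum>S\<in>Pow P. of_int ((-1) ^ card S) * (\<Prod>(i, j)\<in>S. X i * Y j)) = (\<Prod>(i, j)\<in>P. 1 - X i * Y j)"
      using prod_diff_conv_sum[OF finP, of "\<lambda>_. 1" "\<lambda>(i, j). X i * Y j"]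
      by (simp add: case_prod_beta)
    also have "\<dots> = (\<Sum>\<pi> | \<pi> permutes {0..<n}. signof \<pi> * (\<Prod>i<n. Y i ^ i * X i ^ \<pi> i))"
      unfolding P_def
      by (rule raising_product_eq_det) (simp add: X_def Y_def mult_single single_uminus)
    also have "\<Phi> \<dots> = (\<Sum>\<pi> | \<pi> permutes {0..<n}. signof \<pi> * \<Phi> (\<Prod>i<n. Y i ^ i * X i ^ \<pi> i))"
      by (rule \<Phi>_sum) (simp add: finite_permutations)
    also have "\<dots> = (\<Sum>\<pi> | \<pi> permutes {0..<n}. signof \<pi> * (\<Prod>i = 0..<n. u (entry \<alpha> i + int (\<pi> i) - int i)))"
    proof (rule sum.cong[OF refl])
      fix \<pi>
      have pow: "X i ^ k = Poly_Mapping.single (Poly_Mapping.single i (int k)) 1"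
          "Y i ^ k = Poly_Mapping.single (Poly_Mapping.single i (- int k)) 1" for i k
        by (induction k) (simp_all add: X_def Y_def mult_single flip: single_add)
      define \<beta> where "\<beta> = (\<Sum>i<n. Poly_Mapping.single i (int (\<pi> i) - int i))"
      have "(\<Prod>i<n. Y i ^ i * X i ^ \<pi> i) = Poly_Mapping.single \<beta> 1"
        by (simp add: pow mult_single \<beta>_def single_sum flip: single_add)
      moreover have "u_seq (\<alpha> + \<beta>) = (\<Prod>i<n. u (entry (\<alpha> + \<beta>) i))"
        using n n1 by (intro u_seq_eq_prod) (simp add: lookup_add \<beta>_def lookup_sum_single)
      ultimately show "signof \<pi> * \<Phi> (\<Prod>i<n. Y i ^ i * X i ^ \<pi> i)
          = signof \<pi> * (\<Prod>i = 0..<n. u (entry \<alpha> i + int (\<pi> i) - int i))"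
        by (simp add: \<Phi>_single lookup_add \<beta>_def lookup_sum_single atLeast0LessThan algebra_simps)
    qed
    also have "\<dots> = jacobi_trudi u (entry \<alpha>) n"
      unfolding jacobi_trudi_def
      by (subst det_def'[of _ n]) (auto simp: permutes_in_image intro!: sum.cong prod.cong)
    finally show ?thesis .
  qed
  then show ?thesis by blast
qed

section \<open>The duality involution\<close>

text \<open>
  The dual \<open>e\<close> of \<open>u\<close> exists by recursion. Since the conjugate of \<open>(1\<^sup>r)\<close> is \<open>(r)\<close>, the dual Jacobi-Trudi
  identity reads \<open>U\<^bsub>(1\<^sup>r)\<^esub> = e\<^sub>r\<close>, a determinant of size one on the right.
\<close>
lemma dual_pair_u_v: "dual_pair u v"
proof -
  obtain e where e: "dual_pair u e"
    using dual_pair_exists[of u] by (auto simp: u_def)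
  have "e (int r) = v (int r)" if "r > 0" for r
  proof -
    have part: "is_partition (ones r)"
      by (auto simp: is_partition_def ones.rep_eq)
    obtain n0 where n0: "\<And>n. n \<ge> n0 \<Longrightarrow> U (ones r) = jacobi_trudi u (entry (ones r)) n"
      using U_eq_jacobi_trudi by blast
    have "v (int r) = jacobi_trudi u (entry (ones r)) (max n0 r)"
      using that n0[of "max n0 r"] by (simp add: v_def)
    also have "\<dots> = jacobi_trudi e (entry (conjugate (ones r))) 1"
      by (rule dual_jacobi_trudi[OF e part]) (auto simp: ones.rep_eq)
    also have "\<dots> = e (entry (conjugate (ones r)) 0)"
      by (simp add: jacobi_trudi_def det_single)
    also have "entry (conjugate (ones r)) 0 = int r"
    proof -
      have "{j. entry (ones r) j \<ge> 1} = {..<r}"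
        by (auto simp: ones.rep_eq)
      then show ?thesis by (simp add: conjugate.rep_eq)
    qed
    finally show ?thesis by simp
  qed
  moreover have "e r = v r" if "r \<le> 0" for r
    using e that by (auto simp: dual_pair_def v_def)
  ultimately have "e = v"
    by (metis ext not_le of_nat_0_less_iff zero_less_imp_eq_int)
  then show ?thesis using e by simp
qed

text \<open>
  The variables generate the ring: every monomial is built from the \<open>u r\<close> one factor at a time.
\<close>
lemma u_hom_eqI:
  assumes f: "u_hom f" and g: "u_hom g" and eq: "\<And>r. f (u r) = g (u r)"
  shows "f = g"
proof -
  have diff: "f (p - q) = f p - f q" "g (p - q) = g p - g q" for p q
    using f g by (simp_all add: u_hom_diff)
  have zero: "f 0 = g 0" using diff[of 0 0] by simp
  have one: "f 1 = g 1" using f g by (simp add: u_hom_def)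
  have var: "f (frag_of (Poly_Mapping.single k n)) = g (frag_of (Poly_Mapping.single k n))" for k n
  proof (induction n)
    case (Suc n)
    have "frag_of (Poly_Mapping.single k (Suc n)) = u (int k + 1) * frag_of (Poly_Mapping.single k n)"
      by (simp add: u_def mult_single single_add[symmetric] nat_add_distrib)
    then show ?case using f g eq Suc by (simp add: u_hom_def)
  qed (use one in simp)
  have mon: "f (frag_of m) = g (frag_of m)" for m
  proof (induction m rule: update_induct)
    case (update m k n)
    have "Poly_Mapping.update k n m = Poly_Mapping.single k n + m"
      using update(1)
      by (intro poly_mapping_eqI) (auto simp: lookup_update lookup_add lookup_single in_keys_iff)
    then have "frag_of (Poly_Mapping.update k n m) = frag_of (Poly_Mapping.single k n) * frag_of m"
      by (simp add: mult_single)
    then show ?case using f g var update(3) by (simp add: u_hom_def)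
  qed (use one in simp)
  have "f p = g p" for p
    using subset_UNIV[of "Poly_Mapping.keys p"]
    by (induction p rule: frag_induction) (simp_all add: zero mon diff)
  then show ?thesis by blast
qed

lemma u_hom_imp_comm_ring_hom:
  assumes "u_hom f" shows "comm_ring_hom f"
proof
  show "f 0 = 0" using u_hom_diff[OF assms, of 0 0] by simp
qed (use assms in \<open>simp_all add: u_hom_def\<close>)

lemma comm_ring_hom_jacobi_trudi:
  assumes "comm_ring_hom f"
  shows "f (jacobi_trudi h a n) = jacobi_trudi (f \<circ> h) a n"
proof -
  interpret comm_ring_hom f by fact
  have "map_mat f (mat n n (\<lambda>(i, j). h (a i + int j - int i))) = mat n n (\<lambda>(i, j). (f \<circ> h) (a i + int j - int i))"
    by (rule eq_matI) auto
  then show ?thesis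
    by (simp only: jacobi_trudi_def flip: hom_det)
qed

lemma comm_ring_hom_dual_pair:
  assumes "comm_ring_hom f" "dual_pair h e"
  shows "dual_pair (f \<circ> h) (f \<circ> e)"
proof -
  interpret comm_ring_hom f by fact
  have "(\<Sum>i\<le>r. (-1) ^ i * (f \<circ> e) (int i) * (f \<circ> h) (int (r - i))) = 0" if "r > 0" for r
  proof -
    have "(\<Sum>i\<le>r. (-1) ^ i * (f \<circ> e) (int i) * (f \<circ> h) (int (r - i)))
        = f (\<Sum>i\<le>r. (-1) ^ i * e (int i) * h (int (r - i)))"
      by (simp add: hom_distribs)
    then show ?thesis using dual_pair_recurrence[OF assms(2) that] by (simp only: hom_zero)
  qed
  then show ?thesis using assms(2) unfolding dual_pair_def by simp
qed

theorem mainTheorem3: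
  fixes \<omega> :: "upoly \<Rightarrow> upoly"
  assumes "u_hom \<omega>"
    and "\<And>r :: int. \<omega> (u r) = v r"
  shows "(\<forall>l. is_partition l \<longrightarrow> \<omega> (U l) = U (conjugate l)) \<and> \<omega> \<circ> \<omega> = id"
proof
  have \<omega>_u: "\<omega> \<circ> u = v" using assms(2) by auto
  note hom = u_hom_imp_comm_ring_hom[OF assms(1)]
  note dual = dual_pair_u_v dual_pair_sym[OF dual_pair_u_v]
  show "\<forall>l. is_partition l \<longrightarrow> \<omega> (U l) = U (conjugate l)"
  proof (intro allI impI)
    fix l assume part: "is_partition l"
    \<comment> \<open>Both sizes must also contain the diagram of \<open>l\<close>, hence the maxima below.\<close>
    obtain n0 where n0: "\<And>n. n \<ge> n0 \<Longrightarrow> U l = jacobi_trudi u (entry l) n"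
      using U_eq_jacobi_trudi by blast
    obtain m0 where m0: "\<And>m. m \<ge> m0 \<Longrightarrow> U (conjugate l) = jacobi_trudi u (entry (conjugate l)) m"
      using U_eq_jacobi_trudi by blast
    obtain n1 where n1: "\<And>k. k \<ge> n1 \<Longrightarrow> entry l k = 0"
      using finitely_many_nonzero_entries by blast
    have "\<omega> (U l) = \<omega> (jacobi_trudi u (entry l) (max n0 n1))"
      using n0[OF max.cobounded1] by metis
    also have "\<dots> = jacobi_trudi v (entry l) (max n0 n1)"
      by (simp add: comm_ring_hom_jacobi_trudi[OF hom] \<omega>_u)
    also have "\<dots> = jacobi_trudi u (entry (conjugate l)) (max m0 (nat (entry l 0)))"
      by (rule dual_jacobi_trudi[OF dual(2) part]) (auto intro: n1)
    also have "\<dots> = U (conjugate l)"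
      using m0[OF max.cobounded1] by metis
    finally show "\<omega> (U l) = U (conjugate l)" .
  qed
  have "dual_pair v (\<omega> \<circ> v)"
    using comm_ring_hom_dual_pair[OF hom dual(1)] by (simp add: \<omega>_u)
  then have "\<omega> \<circ> v = u"
    using dual(2) by (rule dual_pair_unique)
  then have "(\<omega> \<circ> \<omega>) (u r) = id (u r)" for r
    using assms(2) by (metis comp_apply id_apply)
  moreover have "u_hom (\<omega> \<circ> \<omega>)" "u_hom id"
    using assms(1) by (simp_all add: u_hom_def)
  ultimately show "\<omega> \<circ> \<omega> = id"
    by (intro u_hom_eqI)
qed

end
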